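(* Let $\Gamma$ be a finite simple graph, let $m\ge 1$, and let $M_m$ be a permutable matching of $m$ edges in $\Gamma$. Suppose that for every length $l\in\operatorname{SpecC}(\Gamma)$ there exists a cycle $C_l$ of length $l$ in $\Gamma$ such that $|C_l\cap M_m|=\min(m,\lfloor l/2\rfloor)$, where $|C_l\cap M_m|$ is the number of edges of $M_m$ in $C_l$. Then $\dim\operatorname{NCV}(\Gamma)\ge\nu_{\mathrm{odd}}(m)+\nu_{\mathrm{even}}(m)$.
   Context: A signed graph with underlying graph $\Gamma=(V,E)$ is a pair $(\Gamma,\sigma)$ with $\sigma:E\to\{+,-\}$. The sign of a cycle is the product of the signs of its edges; a cycle is negative if its sign is $-$. The cycle spectrum $\operatorname{SpecC}(\Gamma)$ is the set of lengths of cycles (simple closed paths, as subgraphs) of $\Gamma$. For a signature $\sigma$ let $c_l^-(\sigma)$ be the number of negative cycles of length $l$; the negative cycle vector is $c^-(\sigma)=(c_l^-(\sigma))_{l\in\operatorname{SpecC}(\Gamma)}\in\mathbb{R}^{\operatorname{SpecC}(\Gamma)}$. $\operatorname{NCV}(\Gamma)$ is the set of vectors $c^-(\sigma)$ over all signatures $\sigma$ of $\Gamma$, and $\dim\operatorname{NCV}(\Gamma)$ is the dimension of its linear span. A matching $M$ (set of pairwise nonadjacent edges) is permutable if the automorphisms of $\Gamma$ that map $M$ to itself induce the full symmetric group $S_{|M|}$ on the edges of $M$. $\nu_{\mathrm{odd}}(m)$ is the number of odd $l\in\operatorname{SpecC}(\Gamma)$ with $l<2m$, plus $1$ if there is an odd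 $l\in\operatorname{SpecC}(\Gamma)$ with $l\ge 2m$. $\nu_{\mathrm{even}}(m)$ is the number of even $l\in\operatorname{SpecC}(\Gamma)$ with $l<2m$, plus $1$ if there is an even $l\in\operatorname{SpecC}(\Gamma)$ with $l\ge 2m$. *)

theory Defs
  imports "HOL-Analysis.Analysis" "HOL-Analysis.Finite_Function_Topology"
begin

definition simple_graph :: "'a set \<Rightarrow> 'a set set \<Rightarrow> bool" where
  "simple_graph V E \<longleftrightarrow> finite V \<and> (\<forall>e\<in>E. e \<subseteq> V \<and> card e = 2)"

text \<open>A cycle is a subgraph, not a rooted or oriented closed walk, so it is represented by its
  edge set. The length of a cycle is then the cardinality of that set
  (see \<open>card_cycle_edges\<close>).\<close>

definition cycle_edges :: "'a list \<Rightarrow> 'a set set" where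
  "cycle_edges vs = {{vs ! i, vs ! (Suc i mod length vs)} | i. i < length vs}"

definition is_cycle :: "'a set set \<Rightarrow> 'a set set \<Rightarrow> bool" where
  "is_cycle E C \<longleftrightarrow>
     (\<exists>vs. 3 \<le> length vs \<and> distinct vs \<and> C = cycle_edges vs \<and> C \<subseteq> E)"

lemma card_cycle_edges:
  assumes "3 \<le> length vs" "distinct vs"
  shows "card (cycle_edges vs) = length vs"
proof -
  let ?n = "length vs"
  let ?s = "\<lambda>i. Suc i mod ?n"
  have "inj_on (\<lambda>i. {vs ! i, vs ! ?s i}) {..<?n}"
  proof (rule inj_onI)
    fix i j
    assume ij: "i \<in> {..<?n}" "j \<in> {..<?n}"
      and eq: "{vs ! i, vs ! ?s i} = {vs ! j, vs ! ?s j}"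
    have s: "?s i < ?n" "?s j < ?n" using assms(1) by (auto intro!: mod_less_divisor)
    show "i = j"
    proof (rule ccontr)
      assume "i \<noteq> j"
      with ij assms(2) have "vs ! i \<noteq> vs ! j" by (simp add: nth_eq_iff_index_eq)
      with eq have "vs ! i = vs ! ?s j" "vs ! j = vs ! ?s i"
        by (auto simp: doubleton_eq_iff)
      with ij s assms(2) have "i = ?s j" "j = ?s i"
        by (simp_all only: nth_eq_iff_index_eq lessThan_iff)
      moreover have "?s k = (if Suc k = ?n then 0 else Suc k)" if "k < ?n" for k
        using that by simp
      ultimately show False using ij assms(1)
        by (simp only: lessThan_iff split: if_splits)
    qed
  qed
  moreover have "cycle_edges vs = (\<lambda>i. {vs ! i, vs ! ?s i}) ` {..<?n}"
    by (auto simp: cycle_edges_def)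
  ultimately show ?thesis by (simp add: card_image)
qed

definition SpecC :: "'a set set \<Rightarrow> nat set" where
  "SpecC E = {card C | C. is_cycle E C}"

definition signature :: "'a set set \<Rightarrow> ('a set \<Rightarrow> int) \<Rightarrow> bool" where
  "signature E \<sigma> \<longleftrightarrow> \<sigma> \<in> E \<rightarrow>\<^sub>E {1, -1}"

definition negative_cycle :: "'a set set \<Rightarrow> ('a set \<Rightarrow> int) \<Rightarrow> 'a set set \<Rightarrow> bool" where
  "negative_cycle E \<sigma> C \<longleftrightarrow> is_cycle E C \<and> (\<Prod>e\<in>C. \<sigma> e) = -1"

definition neg_cycle_count :: "'a set set \<Rightarrow> ('a set \<Rightarrow> int) \<Rightarrow> nat \<Rightarrow> nat" where
  "neg_cycle_count E \<sigma> l = card {C. negative_cycle E \<sigma> C \<and> card C = l}"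

text \<open>The space of real vectors indexed by \<open>SpecC E\<close> is embedded, by extension by zero, in the
  real vector space of finitely supported functions \<open>nat \<Rightarrow>\<^sub>0 real\<close>. For a finite graph
  \<open>SpecC E\<close> is finite, so the use of \<open>Abs_poly_mapping\<close> is justified
  (see \<open>lookup_neg_cycle_vector\<close>).\<close>

definition neg_cycle_vector :: "'a set set \<Rightarrow> ('a set \<Rightarrow> int) \<Rightarrow> (nat \<Rightarrow>\<^sub>0 real)" where
  "neg_cycle_vector E \<sigma> =
     Abs_poly_mapping (\<lambda>l. if l \<in> SpecC E then real (neg_cycle_count E \<sigma> l) else 0)"

definition NCV :: "'a set set \<Rightarrow> (nat \<Rightarrow>\<^sub>0 real) set" where
  "NCV E = {neg_cycle_vector E \<sigma> | \<sigma>. signature E \<sigma>}"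

lemma simple_graph_finite_edges:
  assumes "simple_graph V E"
  shows "finite E"
  using assms by (auto simp: simple_graph_def intro: finite_subset[of E "Pow V"])

lemma lookup_neg_cycle_vector:
  assumes "simple_graph V E"
  shows "Poly_Mapping.lookup (neg_cycle_vector E \<sigma>) l =
    (if l \<in> SpecC E then real (neg_cycle_count E \<sigma> l) else 0)"
proof -
  have "SpecC E \<subseteq> card ` Pow E" by (auto simp: SpecC_def is_cycle_def)
  with simple_graph_finite_edges[OF assms] have "finite (SpecC E)"
    by (meson finite_Pow_iff finite_imageI finite_subset)
  then show ?thesis
    unfolding neg_cycle_vector_def by (subst Abs_poly_mapping_inverse) auto
qed

definition is_matching :: "'a set set \<Rightarrow> 'a set set \<Rightarrow> bool" where
  "is_matching E M \<longleftrightarrow> M \<subseteq> E \<and> (\<forall>e\<in>M. \<forall>f\<in>M. e \<noteq> f \<longrightarrow> e \<inter> f = {})"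

definition automorphism :: "'a set \<Rightarrow> 'a set set \<Rightarrow> ('a \<Rightarrow> 'a) \<Rightarrow> bool" where
  "automorphism V E \<phi> \<longleftrightarrow>
     bij_betw \<phi> V V \<and> (\<forall>u\<in>V. \<forall>v\<in>V. {\<phi> u, \<phi> v} \<in> E \<longleftrightarrow> {u, v} \<in> E)"

definition permutable :: "'a set \<Rightarrow> 'a set set \<Rightarrow> 'a set set \<Rightarrow> bool" where
  "permutable V E M \<longleftrightarrow>
     (\<forall>\<pi>. bij_betw \<pi> M M \<longrightarrow>
        (\<exists>\<phi>. automorphism V E \<phi> \<and> (\<lambda>e. \<phi> ` e) ` M = M \<and> (\<forall>e\<in>M. \<phi> ` e = \<pi> e)))"

definition nu_odd :: "'a set set \<Rightarrow> nat \<Rightarrow> nat" where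
  "nu_odd E m = card {l \<in> SpecC E. odd l \<and> l < 2 * m}
     + (if \<exists>l\<in>SpecC E. odd l \<and> l \<ge> 2 * m then 1 else 0)"

definition nu_even :: "'a set set \<Rightarrow> nat \<Rightarrow> nat" where
  "nu_even E m = card {l \<in> SpecC E. even l \<and> l < 2 * m}
     + (if \<exists>l\<in>SpecC E. even l \<and> l \<ge> 2 * m then 1 else 0)"

end

theory Submission
  imports Defs
begin

text \<open>A lower bound for the dimension follows once the coordinate functionals
  \<open>x \<mapsto> x\<^sub>l\<close>, for \<open>l\<close> in a suitable set \<open>L\<close> of lengths, are linearly independent on the set of
  negative cycle vectors (\<open>card_le_dim_if_coordinates_independent\<close>). The set \<open>L\<close> consists of all
  cycle lengths below \<open>2 * m\<close> together with one odd and one even length that are at least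
  \<open>2 * m\<close>, when these exist.

  Only two kinds of signatures are evaluated: for \<open>N \<subseteq> M\<close>, the signature that is negative exactly
  on \<open>N\<close>, and its negation. The two give an even cycle the same sign and an odd cycle opposite
  signs. Hence a linear relation between coordinates in \<open>L\<close> splits into a relation between odd
  lengths and one between even lengths, each saying that a combination of the signed counts
  \<open>G\<^sub>l(N) = (\<Sum>C. (-1) ^ card (C \<inter> N))\<close>, summed over the cycles of length \<open>l\<close>, is
  constant in \<open>N\<close>.

  Writing \<open>-1 = 1 - 2\<close> and expanding turns \<open>G\<^sub>l(N)\<close> into
  \<open>(\<Sum>J\<in>Pow N. (-2) ^ card J * d\<^sub>l(J))\<close>, where \<open>d\<^sub>l(J)\<close> is the number of
  cycles of length \<open>l\<close> containing \<open>J\<close>. By Moebius inversion, the relation between the \<open>G\<^sub>l\<close>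
  becomes one between the numbers \<open>d\<^sub>l(J)\<close> for every nonempty \<open>J \<subseteq> M\<close> separately. A cycle of
  length \<open>l\<close> meets the matching in at most \<open>min m (l div 2)\<close> edges, and some cycle attains this
  bound. Within one parity class of \<open>L\<close> these maxima are pairwise different, so the relation is
  triangular: choose \<open>J\<close> as the intersection of \<open>M\<close> with an extremal cycle for the largest maximum
  that occurs; then \<open>d\<^sub>l(J)\<close> is nonzero for exactly one of the lengths involved, whose
  coefficient must vanish (\<open>signed_intersection_counts_independent\<close>).\<close>

section \<open>Dimension and independent coordinates\<close>

lemma homogeneous_system_nontrivial_solution:
  fixes f :: "'b \<Rightarrow> 'c \<Rightarrow> real"
  assumes "finite B" "finite L" "card B < card L"
  shows "\<exists>\<alpha>. (\<exists>l\<in>L. \<alpha> l \<noteq> 0) \<and> (\<forall>x\<in>B. (\<Sum>l\<in>L. \<alpha> l * f x l) = 0)"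
  using assms
proof (induction B arbitrary: L f rule: finite_induct)
  case empty
  then obtain l where "l \<in> L" by fastforce
  then show ?case by (intro exI[of _ "\<lambda>_. 1"]) auto
next
  case (insert x B)
  show ?case
  proof (cases "\<forall>l\<in>L. f x l = 0")
    case True
    have "card B < card L" using insert.hyps insert.prems by simp
    then obtain \<alpha> where "\<exists>l\<in>L. \<alpha> l \<noteq> 0" "\<forall>y\<in>B. (\<Sum>l\<in>L. \<alpha> l * f y l) = 0"
      using insert.IH[OF insert.prems(1), of f] by blast
    then show ?thesis using True by (intro exI[of _ \<alpha>]) auto
  next
    case False
    then obtain k where k: "k \<in> L" "f x k \<noteq> 0" by blast
    let ?L = "L - {k}"
    \<comment> \<open>Gaussian elimination of the unknown \<open>k\<close> by means of the equation \<open>x\<close>\<close>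
    let ?g = "\<lambda>y l. f y l - f x l * f y k / f x k"
    have "card B < card ?L" using insert.hyps insert.prems k by simp
    then obtain \<alpha> where \<alpha>: "\<exists>l\<in>?L. \<alpha> l \<noteq> 0" "\<forall>y\<in>B. (\<Sum>l\<in>?L. \<alpha> l * ?g y l) = 0"
      using insert.IH[of ?L ?g] insert.prems by blast
    let ?\<alpha> = "\<alpha>(k := - (\<Sum>l\<in>?L. \<alpha> l * f x l) / f x k)"
    have split: "(\<Sum>l\<in>L. ?\<alpha> l * f y l)
        = (\<Sum>l\<in>?L. \<alpha> l * f y l) - (\<Sum>l\<in>?L. \<alpha> l * f x l) / f x k * f y k" for y
    proof -
      have "(\<Sum>l\<in>L. ?\<alpha> l * f y l) = ?\<alpha> k * f y k + (\<Sum>l\<in>?L. ?\<alpha> l * f y l)"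
        using insert.prems k by (simp add: sum.remove)
      also have "(\<Sum>l\<in>?L. ?\<alpha> l * f y l) = (\<Sum>l\<in>?L. \<alpha> l * f y l)"
        by (intro sum.cong) auto
      finally show ?thesis by simp
    qed
    have "(\<Sum>l\<in>L. ?\<alpha> l * f x l) = 0"
      unfolding split using k by simp
    moreover have "(\<Sum>l\<in>L. ?\<alpha> l * f y l) = 0" if "y \<in> B" for y
    proof -
      have "(\<Sum>l\<in>?L. \<alpha> l * ?g y l)
          = (\<Sum>l\<in>?L. \<alpha> l * f y l) - (\<Sum>l\<in>?L. \<alpha> l * f x l) / f x k * f y k"
        by (simp add: algebra_simps sum_subtractf sum_distrib_left sum_divide_distrib)
      then show ?thesis unfolding split using \<alpha>(2) that by simp
    qed
    moreover have "\<exists>l\<in>L. ?\<alpha> l \<noteq> 0" using \<alpha>(1) by auto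
    ultimately show ?thesis by (intro exI[of _ ?\<alpha>]) blast
  qed
qed

text \<open>With fewer than \<open>card L\<close> vectors in a basis \<open>B\<close> of the span, the system expressing
  that a combination of the coordinates in \<open>L\<close> vanishes on \<open>B\<close> has more unknowns than equations;
  a solution then annihilates all of \<open>S\<close>.\<close>

lemma card_le_dim_if_coordinates_independent:
  fixes S :: "('b \<Rightarrow>\<^sub>0 real) set"
  assumes "finite S" "finite L"
    and indep: "\<And>\<alpha> l. \<lbrakk>\<forall>x\<in>S. (\<Sum>k\<in>L. \<alpha> k * Poly_Mapping.lookup x k) = 0; l \<in> L\<rbrakk> \<Longrightarrow> \<alpha> l = 0"
  shows "card L \<le> dim S"
proof (rule ccontr)
  assume less: "\<not> card L \<le> dim S"
  obtain B where B: "B \<subseteq> S" "independent B" "S \<subseteq> span B" "card B = dim S"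
    using basis_exists by metis
  have "finite B" using B(1) assms(1) finite_subset by blast
  then obtain \<alpha> where \<alpha>: "\<exists>l\<in>L. \<alpha> l \<noteq> 0"
      "\<forall>x\<in>B. (\<Sum>l\<in>L. \<alpha> l * Poly_Mapping.lookup x l) = 0"
    using homogeneous_system_nontrivial_solution[OF _ assms(2), of B Poly_Mapping.lookup]
      less B(4) by auto
  have "(\<Sum>l\<in>L. \<alpha> l * Poly_Mapping.lookup x l) = 0" if "x \<in> span B" for x
    using that
  proof (induction rule: span_induct_alt)
    case base
    show ?case by simp
  next
    case (step c x y)
    have "(\<Sum>l\<in>L. \<alpha> l * Poly_Mapping.lookup (c *\<^sub>R x + y) l)
        = c * (\<Sum>l\<in>L. \<alpha> l * Poly_Mapping.lookup x l) + (\<Sum>l\<in>L. \<alpha> l * Poly_Mapping.lookup y l)"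
      by (simp add: lookup_add scaleR_poly_mapping_def distrib_left sum.distrib
          sum_distrib_left mult.left_commute)
    then show ?case using \<alpha>(2) step by simp
  qed
  then show False using indep[of \<alpha>] \<alpha>(1) B(3) by blast
qed

section \<open>Signed intersection counts of set systems\<close>

text \<open>This is the binomial expansion of \<open>(1 + (-2)) ^ card X\<close>, indexed by subsets. It makes the sign
  of an intersection \<open>C \<inter> N\<close> a sum over the sets \<open>J \<subseteq> N\<close> contained in \<open>C\<close>.\<close>

lemma minus_one_power_card_eq_sum_Pow:
  assumes "finite X"
  shows "(-1::real) ^ card X = (\<Sum>J\<in>Pow X. (-2) ^ card J)"
  using assms
proof (induction X rule: finite_induct)
  case (insert x X)
  have "(\<Sum>J\<in>Pow (insert x X). (-2::real) ^ card J)
      = (\<Sum>J\<in>Pow X. (-2) ^ card J) + (\<Sum>J\<in>insert x ` Pow X. (-2) ^ card J)"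
    unfolding Pow_insert using insert.hyps by (intro sum.union_disjoint) auto
  also have "(\<Sum>J\<in>insert x ` Pow X. (-2::real) ^ card J) = (\<Sum>J\<in>Pow X. (-2) ^ card (insert x J))"
    using insert.hyps by (intro sum.reindex_cong[of "insert x"]) (auto simp: inj_on_def)
  also have "\<dots> = (\<Sum>J\<in>Pow X. (-2) * (-2) ^ card J)"
  proof (intro sum.cong refl)
    fix J assume "J \<in> Pow X"
    then have "finite J" "x \<notin> J" using insert.hyps finite_subset by auto
    then show "(-2::real) ^ card (insert x J) = (-2) * (-2) ^ card J" by simp
  qed
  also have "\<dots> = -2 * (\<Sum>J\<in>Pow X. (-2) ^ card J)" by (simp only: sum_distrib_left)
  finally show ?case using insert by simp
qed simp

lemma signed_intersection_count_expansion:
  assumes "finite \<C>" "finite N"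
  shows "(\<Sum>C\<in>\<C>. (-1::real) ^ card (C \<inter> N))
    = (\<Sum>J\<in>Pow N. (-2) ^ card J * real (card {C\<in>\<C>. J \<subseteq> C}))"
proof -
  have "(-1::real) ^ card (C \<inter> N) = (\<Sum>J\<in>Pow N. if J \<subseteq> C then (-2) ^ card J else 0)" for C
  proof -
    have "Pow (C \<inter> N) = {J \<in> Pow N. J \<subseteq> C}" by auto
    then show ?thesis
      using assms(2) minus_one_power_card_eq_sum_Pow[of "C \<inter> N"]
      by (simp only: sum.inter_filter finite_Pow_iff finite_Int simp_thms)
  qed
  then have "(\<Sum>C\<in>\<C>. (-1::real) ^ card (C \<inter> N))
      = (\<Sum>J\<in>Pow N. \<Sum>C\<in>\<C>. if J \<subseteq> C then (-2) ^ card J else 0)"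
    by (simp only:) (rule sum.swap)
  also have "\<dots> = (\<Sum>J\<in>Pow N. (-2) ^ card J * real (card {C\<in>\<C>. J \<subseteq> C}))"
    using assms(1) by (intro sum.cong refl) (simp add: mult.commute flip: sum.inter_filter)
  finally show ?thesis .
qed

text \<open>This is Moebius inversion on the Boolean lattice, for the constant function \<open>c\<close>:
  a constant is the subset sum of a function supported on the empty set only.\<close>

lemma zero_if_subset_sums_constant:
  fixes \<beta> :: "'b set \<Rightarrow> real"
  assumes "finite M" and const: "\<And>N. N \<subseteq> M \<Longrightarrow> (\<Sum>J\<in>Pow N. \<beta> J) = c"
    and "J \<subseteq> M" "J \<noteq> {}"
  shows "\<beta> J = 0"
proof -
  have "finite J" using assms finite_subset by blast
  then show ?thesis using assms(3,4)
  proof (induction J rule: finite_psubset_induct)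
    case (psubset J)
    have "Pow J = insert J (insert {} (Pow J - {{}, J}))" by auto
    then have "(\<Sum>K\<in>Pow J. \<beta> K) = (\<Sum>K\<in>insert J (insert {} (Pow J - {{}, J})). \<beta> K)" by simp
    also have "\<dots> = \<beta> J + (\<beta> {} + (\<Sum>K\<in>Pow J - {{}, J}. \<beta> K))"
      using psubset by simp
    also have "(\<Sum>K\<in>Pow J - {{}, J}. \<beta> K) = 0"
      using psubset by (intro sum.neutral) auto
    also have "\<beta> {} = c" using const[of "{}"] by simp
    finally show ?case using const[OF psubset.prems(1)] by simp
  qed
qed

text \<open>The family of the \<open>\<C> l\<close> is triangular with respect to the maximal sizes \<open>\<mu> l\<close> of intersections
  with \<open>M\<close>. Positivity of \<open>\<mu>\<close> makes the decisive set \<open>J\<close> nonempty, which is why combinations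
  that are merely constant in \<open>N\<close>, rather than zero, are already trivial.\<close>

lemma signed_intersection_counts_independent:
  fixes \<C> :: "'l \<Rightarrow> 'b set set" and \<mu> :: "'l \<Rightarrow> nat" and \<alpha> :: "'l \<Rightarrow> real"
  assumes "finite A" "finite M"
    and fin: "\<And>k. k \<in> A \<Longrightarrow> finite (\<C> k)"
    and attained: "\<And>k. k \<in> A \<Longrightarrow> \<exists>C\<in>\<C> k. card (C \<inter> M) = \<mu> k"
    and bound: "\<And>k C. k \<in> A \<Longrightarrow> C \<in> \<C> k \<Longrightarrow> card (C \<inter> M) \<le> \<mu> k"
    and "inj_on \<mu> A" and pos: "\<And>k. k \<in> A \<Longrightarrow> \<mu> k > 0"
    and const: "\<And>N. N \<subseteq> M \<Longrightarrow> (\<Sum>k\<in>A. \<alpha> k * (\<Sum>C\<in>\<C> k. (-1) ^ card (C \<inter> N))) = c"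
    and "l \<in> A"
  shows "\<alpha> l = 0"
proof (rule ccontr)
  assume "\<alpha> l \<noteq> 0"
  let ?A = "{k\<in>A. \<alpha> k \<noteq> 0}"
  have A: "finite ?A" "?A \<noteq> {}" using assms(1) \<open>l \<in> A\<close> \<open>\<alpha> l \<noteq> 0\<close> by auto
  have "Max (\<mu> ` ?A) \<in> \<mu> ` ?A" using A by (intro Max_in) auto
  then obtain t where t: "t \<in> ?A" "\<mu> t = Max (\<mu> ` ?A)" by (elim imageE) simp
  have less: "\<mu> k < \<mu> t" if "k \<in> ?A" "k \<noteq> t" for k
  proof -
    have "\<mu> k \<le> \<mu> t" using A that t(2) by simp
    moreover have "\<mu> k \<noteq> \<mu> t" using that t(1) assms(6) by (auto simp: inj_on_def)
    ultimately show ?thesis by simp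
  qed
  obtain C where C: "C \<in> \<C> t" "card (C \<inter> M) = \<mu> t" using attained t(1) by blast
  let ?J = "C \<inter> M"
  let ?d = "\<lambda>k J. real (card {C\<in>\<C> k. J \<subseteq> C})"
  have "?J \<noteq> {}" using C(2) pos[of t] t(1) by force
  moreover have "(\<Sum>J\<in>Pow N. (-2) ^ card J * (\<Sum>k\<in>A. \<alpha> k * ?d k J)) = c" if "N \<subseteq> M" for N
  proof -
    have "finite N" using that assms(2) finite_subset by blast
    then have "(\<Sum>k\<in>A. \<alpha> k * (\<Sum>C\<in>\<C> k. (-1) ^ card (C \<inter> N)))
        = (\<Sum>k\<in>A. \<Sum>J\<in>Pow N. (-2) ^ card J * (\<alpha> k * ?d k J))"
      using fin by (simp add: signed_intersection_count_expansion sum_distrib_left mult_ac)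
    also have "\<dots> = (\<Sum>J\<in>Pow N. (-2) ^ card J * (\<Sum>k\<in>A. \<alpha> k * ?d k J))"
      by (subst sum.swap) (simp only: sum_distrib_left)
    finally show ?thesis using const[OF that] by simp
  qed
  ultimately have "(-2) ^ card ?J * (\<Sum>k\<in>A. \<alpha> k * ?d k ?J) = 0"
    using zero_if_subset_sums_constant[OF assms(2),
        of "\<lambda>J. (-2) ^ card J * (\<Sum>k\<in>A. \<alpha> k * ?d k J)" c ?J] by blast
  then have "(\<Sum>k\<in>A. \<alpha> k * ?d k ?J) = 0" by simp
  moreover have "(\<Sum>k\<in>A. \<alpha> k * ?d k ?J) = (\<Sum>k\<in>{t}. \<alpha> k * ?d k ?J)"
  proof (intro sum.mono_neutral_right ballI)
    fix k assume k: "k \<in> A - {t}"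
    show "\<alpha> k * ?d k ?J = 0"
    proof (cases "\<alpha> k = 0")
      case False
      have "\<not> ?J \<subseteq> D" if "D \<in> \<C> k" for D
      proof
        assume "?J \<subseteq> D"
        then have "card ?J \<le> card (D \<inter> M)" using assms(2) by (intro card_mono) auto
        then show False using bound[of k D] that k False less[of k] C(2) by auto
      qed
      then have "{D \<in> \<C> k. ?J \<subseteq> D} = {}" by blast
      then show ?thesis by (simp only: card.empty of_nat_0 mult_zero_right)
    qed simp
  qed (use assms(1) t(1) in auto)
  moreover have "?d t ?J > 0" using C(1) fin t(1) by (auto simp: card_gt_0_iff)
  ultimately show False using t(1) by simp
qed

section \<open>Cycles and matchings\<close>

definition cycles :: "'a set set \<Rightarrow> nat \<Rightarrow> 'a set set set" where
  "cycles E l = {C. is_cycle E C \<and> card C = l}"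

lemma finite_cycles:
  assumes "finite E"
  shows "finite (cycles E l)"
  by (rule finite_subset[of _ "Pow E"]) (use assms in \<open>auto simp: cycles_def is_cycle_def\<close>)

lemma finite_SpecC:
  assumes "finite E"
  shows "finite (SpecC E)"
  by (rule finite_subset[of _ "card ` Pow E"])
    (use assms in \<open>auto simp: SpecC_def is_cycle_def\<close>)

lemma SpecC_ge_3: "l \<in> SpecC E \<Longrightarrow> 3 \<le> l"
  by (auto simp: SpecC_def is_cycle_def card_cycle_edges)

text \<open>A cycle has as many vertices as edges, and the matching edges on it use up two vertices
  each.\<close>

lemma card_cycle_inter_matching_le:
  assumes "simple_graph V E" "is_matching E M" "is_cycle E C"
  shows "2 * card (C \<inter> M) \<le> card C"
proof -
  obtain vs where vs: "3 \<le> length vs" "distinct vs" "C = cycle_edges vs" "C \<subseteq> E"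
    using assms(3) by (auto simp: is_cycle_def)
  have two: "card e = 2" if "e \<in> C \<inter> M" for e
    using assms(1) vs(4) that by (auto simp: simple_graph_def)
  have "pairwise disjnt (C \<inter> M)"
    using assms(2) by (auto simp: is_matching_def pairwise_def disjnt_def)
  moreover have "finite e" if "e \<in> C \<inter> M" for e using two[OF that] card.infinite by fastforce
  ultimately have "card (\<Union>(C \<inter> M)) = (\<Sum>e\<in>C \<inter> M. card e)"
    by (intro card_Union_disjoint)
  also have "\<dots> = 2 * card (C \<inter> M)" using two by simp
  finally have "2 * card (C \<inter> M) = card (\<Union>(C \<inter> M))" by simp
  also have "\<dots> \<le> card (set vs)"
  proof (intro card_mono)
    have "Suc i mod length vs < length vs" for i using vs(1) by (intro mod_less_divisor) auto
    then show "\<Union>(C \<inter> M) \<subseteq> set vs" unfolding vs(3) cycle_edges_def by auto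
  qed simp
  also have "\<dots> = card C" using vs by (simp add: distinct_card card_cycle_edges)
  finally show ?thesis .
qed

section \<open>Signatures supported on a matching\<close>

definition signature_on :: "'a set set \<Rightarrow> int \<Rightarrow> 'a set set \<Rightarrow> 'a set \<Rightarrow> int" where
  "signature_on E \<epsilon> N = restrict (\<lambda>e. \<epsilon> * (if e \<in> N then -1 else 1)) E"

lemma signature_signature_on:
  "\<epsilon> \<in> {1, -1} \<Longrightarrow> signature E (signature_on E \<epsilon> N)"
  unfolding signature_def signature_on_def by (rule restrict_PiE_iff[THEN iffD2]) auto

lemma prod_signature_on:
  assumes "finite C" "C \<subseteq> E"
  shows "(\<Prod>e\<in>C. signature_on E \<epsilon> N e) = \<epsilon> ^ card C * (-1) ^ card (C \<inter> N)"
proof -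
  have "(\<Prod>e\<in>C. signature_on E \<epsilon> N e) = (\<Prod>e\<in>C. \<epsilon> * (if e \<in> N then -1 else 1))"
    using assms(2) by (intro prod.cong) (auto simp: signature_on_def)
  also have "\<dots> = \<epsilon> ^ card C * (\<Prod>e\<in>C. if e \<in> N then -1 else 1)"
    by (simp add: prod.distrib)
  also have "(\<Prod>e\<in>C. if e \<in> N then -1 else 1 :: int) = (\<Prod>e\<in>C \<inter> N. -1)"
    using assms(1) by (rule prod.inter_restrict[symmetric])
  finally show ?thesis by simp
qed

lemma neg_cycle_count_signature_on:
  assumes "finite E" "\<epsilon> \<in> {1, -1}"
  shows "2 * real (neg_cycle_count E (signature_on E \<epsilon> N) l)
    = real (card (cycles E l)) - of_int \<epsilon> ^ l * (\<Sum>C\<in>cycles E l. (-1) ^ card (C \<inter> N))"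
proof -
  let ?s = "\<lambda>C. \<epsilon> ^ l * (-1) ^ card (C \<inter> N)"
  have "(\<Prod>e\<in>C. signature_on E \<epsilon> N e) = ?s C" if "C \<in> cycles E l" for C
  proof -
    have "C \<subseteq> E" "card C = l" using that by (auto simp: cycles_def is_cycle_def)
    then show ?thesis using prod_signature_on[of C E] assms(1) finite_subset by blast
  qed
  then have "{C. negative_cycle E (signature_on E \<epsilon> N) C \<and> card C = l}
      = {C \<in> cycles E l. ?s C = -1}"
    by (auto simp: negative_cycle_def cycles_def)
  then have "2 * real (neg_cycle_count E (signature_on E \<epsilon> N) l)
      = (\<Sum>C\<in>cycles E l. if ?s C = -1 then 2 else 0)"
    using finite_cycles[OF assms(1)] by (simp add: neg_cycle_count_def flip: sum.inter_filter)
  also have "\<dots> = (\<Sum>C\<in>cycles E l. 1 - of_int (?s C))"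
  proof (intro sum.cong refl)
    fix C
    have "\<epsilon> ^ l \<in> {1, -1}" using assms(2) by (cases "even l") auto
    moreover have "(-1::int) ^ card (C \<inter> N) \<in> {1, -1}" by (cases "even (card (C \<inter> N))") auto
    ultimately have "?s C \<in> {1, -1}" by auto
    moreover have "(if s = -1 then 2 else 0) = (1 - of_int s :: real)" if "s \<in> {1, -1}" for s :: int
      using that by auto
    ultimately show "(if ?s C = -1 then 2 else 0) = (1 - of_int (?s C) :: real)" by blast
  qed
  finally show ?thesis by (simp add: sum_subtractf sum_distrib_left)
qed

section \<open>The dimension bound\<close>

text \<open>All lengths from \<open>2 * m\<close> on have the same maximal intersection size \<open>m\<close> with the matching, so
  only one of them can enter a triangular system. Which one is irrelevant, hence the choice
  operator.\<close>

definition parity_lengths :: "'a set set \<Rightarrow> nat \<Rightarrow> (nat \<Rightarrow> bool) \<Rightarrow> nat set" where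
  "parity_lengths E m P = {l \<in> SpecC E. P l \<and> l < 2 * m}
     \<union> (if \<exists>l\<in>SpecC E. P l \<and> l \<ge> 2 * m then {SOME l. l \<in> SpecC E \<and> P l \<and> l \<ge> 2 * m} else {})"

lemma parity_lengths_cases:
  assumes "l \<in> parity_lengths E m P"
  shows "l \<in> SpecC E \<and> P l
    \<and> (l < 2 * m \<or> l \<ge> 2 * m \<and> l = (SOME l. l \<in> SpecC E \<and> P l \<and> l \<ge> 2 * m))"
proof (cases "\<exists>l\<in>SpecC E. P l \<and> l \<ge> 2 * m")
  case True
  then have "(SOME l. l \<in> SpecC E \<and> P l \<and> l \<ge> 2 * m) \<in> {l. l \<in> SpecC E \<and> P l \<and> l \<ge> 2 * m}"
    using someI_ex[of "\<lambda>l. l \<in> SpecC E \<and> P l \<and> l \<ge> 2 * m"] by blast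
  then show ?thesis using assms True by (auto simp: parity_lengths_def)
next
  case False
  then have "l \<in> {l \<in> SpecC E. P l \<and> l < 2 * m}"
    using assms unfolding parity_lengths_def if_not_P[OF False] by simp
  then show ?thesis by blast
qed

lemma card_parity_lengths:
  assumes "finite E"
  shows "card (parity_lengths E m P) = card {l \<in> SpecC E. P l \<and> l < 2 * m}
     + (if \<exists>l\<in>SpecC E. P l \<and> l \<ge> 2 * m then 1 else 0)"
proof (cases "\<exists>l\<in>SpecC E. P l \<and> l \<ge> 2 * m")
  case True
  let ?k = "SOME l. l \<in> SpecC E \<and> P l \<and> l \<ge> 2 * m"
  have "?k \<ge> 2 * m"
    using True someI_ex[of "\<lambda>l. l \<in> SpecC E \<and> P l \<and> l \<ge> 2 * m"] by blast
  then have "?k \<notin> {l \<in> SpecC E. P l \<and> l < 2 * m}" by simp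
  moreover have "parity_lengths E m P = insert ?k {l \<in> SpecC E. P l \<and> l < 2 * m}"
    unfolding parity_lengths_def if_P[OF True] by simp
  ultimately show ?thesis using True finite_SpecC[OF assms] by simp
next
  case False
  then show ?thesis unfolding parity_lengths_def if_not_P[OF False] by simp
qed

text \<open>Halving identifies only \<open>2 * d\<close> with \<open>2 * d + 1\<close>, which have different parities; this is
  why odd and even lengths are treated as two separate systems.\<close>

lemma inj_on_half_parity_lengths:
  assumes same_parity: "\<And>k l. P k \<Longrightarrow> P l \<Longrightarrow> k mod 2 = l mod 2"
  shows "inj_on (\<lambda>l. min m (l div 2)) (parity_lengths E m P)"
proof (rule inj_onI)
  fix k l
  assume kl: "k \<in> parity_lengths E m P" "l \<in> parity_lengths E m P"
    and eq: "min m (k div 2) = min m (l div 2)"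
  note cases = parity_lengths_cases[OF kl(1)] parity_lengths_cases[OF kl(2)]
  have par: "k mod 2 = l mod 2" using cases same_parity by blast
  show "k = l"
  proof (cases "k < 2 * m")
    case True
    then have "k div 2 = l div 2" using eq by linarith
    then show ?thesis using par by (metis div_mult_mod_eq)
  next
    case False
    then have "\<not> l < 2 * m" using eq by linarith
    then show ?thesis using False cases by metis
  qed
qed

theorem theorem3p4:
  fixes V :: "'a set" and E M :: "'a set set" and m :: nat
  assumes "simple_graph V E"
    and "m \<ge> 1"
    and "is_matching E M" and "card M = m" and "permutable V E M"
    and "\<forall>l\<in>SpecC E. \<exists>C. is_cycle E C \<and> card C = l \<and> card (C \<inter> M) = min m (l div 2)"
  shows "dim (NCV E) \<ge> nu_odd E m + nu_even E m"
proof -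
  have finE: "finite E" using assms(1) by (rule simple_graph_finite_edges)
  have finM: "finite M" using assms(3) finE by (auto simp: is_matching_def intro: finite_subset)
  let ?O = "parity_lengths E m odd" and ?E = "parity_lengths E m even"
  let ?T = "\<lambda>l. real (card (cycles E l))"
  let ?G = "\<lambda>l N. \<Sum>C\<in>cycles E l. (-1::real) ^ card (C \<inter> N)"
  have sub: "parity_lengths E m P \<subseteq> SpecC E" for P using parity_lengths_cases by blast
  then have finP: "finite (parity_lengths E m P)" for P
    using finite_SpecC[OF finE] finite_subset by blast
  have par: "l \<in> ?O \<Longrightarrow> odd l" "l \<in> ?E \<Longrightarrow> even l" for l
    using parity_lengths_cases by blast+
  then have disj: "?O \<inter> ?E = {}" by blast

  have trivial_if_constant: "\<alpha> l = 0"
    if const: "\<And>N. N \<subseteq> M \<Longrightarrow> (\<Sum>k\<in>parity_lengths E m P. \<alpha> k * ?G k N) = c"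
      and P: "\<And>k l. P k \<Longrightarrow> P l \<Longrightarrow> k mod 2 = l mod 2"
      and l: "l \<in> parity_lengths E m P" for P \<alpha> c l
  proof (rule signed_intersection_counts_independent[where \<C> = "cycles E"
        and \<mu> = "\<lambda>l. min m (l div 2)" and A = "parity_lengths E m P" and M = M
        and \<alpha> = \<alpha> and c = c])
    show "finite (parity_lengths E m P)" by (rule finP)
    show "finite M" by (rule finM)
    show "finite (cycles E k)" for k by (rule finite_cycles[OF finE])
    show "inj_on (\<lambda>l. min m (l div 2)) (parity_lengths E m P)"
      by (intro inj_on_half_parity_lengths P)
    show "\<exists>C\<in>cycles E k. card (C \<inter> M) = min m (k div 2)"
      if "k \<in> parity_lengths E m P" for k
      using assms(6) sub[of P] that by (fastforce simp: cycles_def)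
    show "card (C \<inter> M) \<le> min m (k div 2)" if "C \<in> cycles E k" for k C
    proof -
      have "card (C \<inter> M) \<le> m" using assms(4) finM by (auto intro: card_mono)
      moreover have "2 * card (C \<inter> M) \<le> k"
        using card_cycle_inter_matching_le[OF assms(1,3)] that by (auto simp: cycles_def)
      ultimately show ?thesis by simp
    qed
    show "min m (k div 2) > 0" if "k \<in> parity_lengths E m P" for k
    proof -
      have "3 \<le> k" using SpecC_ge_3 sub[of P] that by blast
      then show ?thesis using assms(2) by simp
    qed
  qed (fact const l)+

  have "card (?O \<union> ?E) \<le> dim (NCV E)"
  proof (rule card_le_dim_if_coordinates_independent)
    have "NCV E = neg_cycle_vector E ` (E \<rightarrow>\<^sub>E {1, -1})"
      by (auto simp: NCV_def signature_def)
    then show "finite (NCV E)" using finE by (simp add: finite_PiE)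
    show "finite (?O \<union> ?E)" using finP by simp
  next
    fix \<alpha> :: "nat \<Rightarrow> real" and l
    assume rel: "\<forall>x\<in>NCV E. (\<Sum>k\<in>?O \<union> ?E. \<alpha> k * Poly_Mapping.lookup x k) = 0"
      and l: "l \<in> ?O \<union> ?E"
    have "(\<Sum>k\<in>?O \<union> ?E. \<alpha> k * (?T k - of_int \<epsilon> ^ k * ?G k N)) = 0" if "\<epsilon> \<in> {1, -1}" for \<epsilon> N
    proof -
      let ?x = "neg_cycle_vector E (signature_on E \<epsilon> N)"
      have "2 * Poly_Mapping.lookup ?x k = ?T k - of_int \<epsilon> ^ k * ?G k N" if "k \<in> ?O \<union> ?E" for k
      proof -
        have "k \<in> SpecC E" using sub that by blast
        then show ?thesis
          using neg_cycle_count_signature_on[OF finE \<open>\<epsilon> \<in> {1, -1}\<close>]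
          by (simp add: lookup_neg_cycle_vector[OF assms(1)])
      qed
      then have "(\<Sum>k\<in>?O \<union> ?E. \<alpha> k * (?T k - of_int \<epsilon> ^ k * ?G k N))
          = (\<Sum>k\<in>?O \<union> ?E. 2 * (\<alpha> k * Poly_Mapping.lookup ?x k))"
        by (intro sum.cong refl) (simp only: mult.left_commute[of 2])
      also have "\<dots> = 2 * (\<Sum>k\<in>?O \<union> ?E. \<alpha> k * Poly_Mapping.lookup ?x k)"
        by (simp only: sum_distrib_left)
      also have "(\<Sum>k\<in>?O \<union> ?E. \<alpha> k * Poly_Mapping.lookup ?x k) = 0"
      proof -
        have "?x \<in> NCV E" using signature_signature_on[OF that] by (auto simp: NCV_def)
        then show ?thesis using rel by blast
      qed
      finally show ?thesis by simp
    qed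
    then have rel_pm: "(\<Sum>k\<in>?O. \<alpha> k * (?T k - of_int \<epsilon> ^ k * ?G k N))
        + (\<Sum>k\<in>?E. \<alpha> k * (?T k - of_int \<epsilon> ^ k * ?G k N)) = 0" if "\<epsilon> \<in> {1, -1}" for \<epsilon> N
      using that finP disj by (simp only: sum.union_disjoint)
    have even_part: "(\<Sum>k\<in>?E. \<alpha> k * (?T k - of_int \<epsilon> ^ k * ?G k N))
        = (\<Sum>k\<in>?E. \<alpha> k * ?T k) - (\<Sum>k\<in>?E. \<alpha> k * ?G k N)" if "\<epsilon> \<in> {1, -1}" for \<epsilon> N
    proof -
      have "of_int \<epsilon> ^ k = (1::real)" if "k \<in> ?E" for k
        using \<open>\<epsilon> \<in> {1, -1}\<close> par(2)[OF that] by auto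
      then show ?thesis by (simp add: right_diff_distrib sum_subtractf cong: sum.cong)
    qed
    have odd_part: "(\<Sum>k\<in>?O. \<alpha> k * (?T k - of_int \<epsilon> ^ k * ?G k N))
        = (\<Sum>k\<in>?O. \<alpha> k * ?T k) - of_int \<epsilon> * (\<Sum>k\<in>?O. \<alpha> k * ?G k N)" if "\<epsilon> \<in> {1, -1}" for \<epsilon> N
    proof -
      have "of_int \<epsilon> ^ k = (of_int \<epsilon> :: real)" if "k \<in> ?O" for k
        using \<open>\<epsilon> \<in> {1, -1}\<close> par(1)[OF that] by auto
      then have "(\<Sum>k\<in>?O. \<alpha> k * (?T k - of_int \<epsilon> ^ k * ?G k N))
          = (\<Sum>k\<in>?O. \<alpha> k * ?T k - of_int \<epsilon> * (\<alpha> k * ?G k N))"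
        by (intro sum.cong refl) (simp only: right_diff_distrib mult.left_commute)
      also have "\<dots> = (\<Sum>k\<in>?O. \<alpha> k * ?T k) - of_int \<epsilon> * (\<Sum>k\<in>?O. \<alpha> k * ?G k N)"
        by (simp only: sum_subtractf sum_distrib_left[of "of_int \<epsilon>"])
      finally show ?thesis .
    qed
    have combined: "(\<Sum>k\<in>?O. \<alpha> k * ?T k) - of_int \<epsilon> * (\<Sum>k\<in>?O. \<alpha> k * ?G k N)
        + ((\<Sum>k\<in>?E. \<alpha> k * ?T k) - (\<Sum>k\<in>?E. \<alpha> k * ?G k N)) = 0" if "\<epsilon> \<in> {1, -1}" for \<epsilon> N
      using rel_pm[OF that] by (simp only: even_part[OF that] odd_part[OF that])
    have odd_rel: "(\<Sum>k\<in>?O. \<alpha> k * ?G k N) = 0" for N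
      using combined[of 1 N] combined[of "-1" N] by simp
    have even_rel: "(\<Sum>k\<in>?E. \<alpha> k * ?G k N) = (\<Sum>k\<in>?O. \<alpha> k * ?T k) + (\<Sum>k\<in>?E. \<alpha> k * ?T k)" for N
      using combined[of 1 N] odd_rel[of N] by simp
    show "\<alpha> l = 0"
      using l trivial_if_constant[OF odd_rel] trivial_if_constant[OF even_rel]
      by (auto simp: odd_iff_mod_2_eq_one even_iff_mod_2_eq_zero)
  qed
  then show ?thesis
    using card_Un_disjoint[OF finP finP disj]
    by (simp add: card_parity_lengths[OF finE] nu_odd_def nu_even_def)
qed

end
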